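(* Let $a\in(0,1)$ and let $k\in\{2n : n\in\mathbb{N}_0\}$ be an even nonnegative integer. Then the function $$f_{a,k}(x)=\psi^{(k)}(x+a)-\psi^{(k)}(x)-\frac{a\,k!}{x^{k+1}}$$ is strictly completely monotonic on $(0,\infty)$.
   Context: $\mathbb{N}_0=\{0,1,2,\dots\}$. $\Gamma$ is the classical Gamma function, $\psi(x)=\frac{d}{dx}\ln\Gamma(x)$ for $x>0$ is the digamma function, $\psi^{(k)}$ is its $k$-th derivative (polygamma function), and $\psi^{(0)}=\psi$. A function $f:(0,\infty)\to\mathbb{R}$ is completely monotonic on $(0,\infty)$ if it has derivatives of all orders and $(-1)^n f^{(n)}(x)\ge 0$ for all $x\in(0,\infty)$ and all $n\in\mathbb{N}_0$; it is strictly completely monotonic if these inequalities are strict, i.e. $(-1)^n f^{(n)}(x)>0$ for all $x\in(0,\infty)$ and all $n\in\mathbb{N}_0$. *)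

theory Defs
  imports "HOL-Analysis.Analysis"
begin

text \<open>
  Real functions are total, so \<open>f\<close> may take arbitrary values on the nonpositive reals; as
  \<open>(0, \<infinity>)\<close> is open, the derivatives at positive points do not depend on those values.
  Since \<^term>\<open>deriv\<close> is unspecified where no derivative exists, differentiability of every
  iterated derivative is required explicitly.
\<close>

definition strictly_completely_monotonic :: "(real \<Rightarrow> real) \<Rightarrow> bool" where
  "strictly_completely_monotonic f \<longleftrightarrow>
     (\<forall>n. \<forall>x>0. (deriv ^^ n) f differentiable (at x)) \<and>
     (\<forall>n. \<forall>x>0. (-1) ^ n * (deriv ^^ n) f x > 0)"

text \<open>
  The library introduces \<^const>\<open>Polygamma\<close> by a series; on the positive reals it is the iterated
  derivative of the logarithmic derivative of \<^const>\<open>Gamma\<close>.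
\<close>

lemma Polygamma_eq_higher_deriv_ln_Gamma:
  assumes "x > (0::real)"
  shows "Polygamma k x = (deriv ^^ k) (deriv (\<lambda>y. ln (Gamma y))) x"
  using assms
proof (induction k arbitrary: x)
  case 0
  have "eventually (\<lambda>y. ln (Gamma y) = ln_Gamma y) (nhds x)"
    using eventually_nhds_in_open[of "{0<..}" x] 0
    by (auto elim!: eventually_mono simp: Gamma_real_pos_exp)
  then have "deriv (\<lambda>y. ln (Gamma y)) x = deriv ln_Gamma x"
    by (rule deriv_cong_ev) simp
  then show ?case
    using 0 by (simp add: deriv_ln_Gamma_real)
next
  case (Suc k)
  have "eventually (\<lambda>y. (deriv ^^ k) (deriv (\<lambda>y. ln (Gamma y))) y = Polygamma k y) (nhds x)"
    using eventually_nhds_in_open[of "{0<..}" x] Suc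
    by (auto elim!: eventually_mono)
  then have "deriv ((deriv ^^ k) (deriv (\<lambda>y. ln (Gamma y)))) x = deriv (Polygamma k) x"
    by (rule deriv_cong_ev) simp
  also have "\<dots> = Polygamma (Suc k) x"
    using Suc.prems by (intro DERIV_imp_deriv has_field_derivative_Polygamma)
      (auto elim!: nonpos_Ints_cases)
  finally show ?case
    by simp
qed

end

theory Submission
  imports Defs
begin

text \<open>
  Differentiating \<open>n\<close> times turns the claim for an even \<open>k\<close> into the inequality
  \<open>(-1)\<^sup>m (\<psi>\<^bsup>(m)\<^esup>(x + a) - \<psi>\<^bsup>(m)\<^esup>(x)) > a m! / x\<^bsup>m+1\<^esup>\<close> for \<open>m = k + n\<close>. With \<open>h(t) = 1 / t\<^bsup>m+1\<^esup>\<close>,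
  the left-hand side divided by \<open>m!\<close> is the series of \<open>h(x+i) - h(x+a+i)\<close>, while \<open>a h(x)\<close> is the
  telescoping series of \<open>a (h(x+i) - h(x+i+1))\<close>. Strict convexity of \<open>h\<close>, applied to
  \<open>x + a + i = (1 - a) (x + i) + a (x + i + 1)\<close>, compares the two series term by term.
\<close>

lemma convex_power_nonneg: "convex_on {0::real..} (\<lambda>x. x ^ n)"
  by (cases "even n")
    (auto intro: convex_power_odd convex_on_subset[OF convex_power_even])

text \<open>Strictness comes from the exponent 1, where the gap is an explicit positive multiple of
  \<open>(x - y)\<^sup>2\<close>. Raising to the power \<open>p\<close> preserves it, and the
  convexity of \<open>t ^ p\<close> at the points \<open>1 / x\<close> and \<open>1 / y\<close> does
  the rest.\<close>

lemma inverse_power_strict_convex: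
  fixes x y a :: real
  assumes "0 < x" "0 < y" "x \<noteq> y" "0 < a" "a < 1" "0 < p"
  shows "1 / ((1 - a) * x + a * y) ^ p < (1 - a) * (1 / x ^ p) + a * (1 / y ^ p)"
proof -
  define z where "z = (1 - a) * x + a * y"
  have z: "z > 0"
    using assms by (auto simp: z_def intro!: add_pos_pos)
  have "((1 - a) * (1 / x) + a * (1 / y)) * z - 1 = a * (1 - a) * (x - y)\<^sup>2 / (x * y)"
    using assms by (simp add: z_def field_simps power2_eq_square)
  also have "\<dots> > 0"
    using assms by simp
  finally have "1 / z < (1 - a) * (1 / x) + a * (1 / y)"
    using z by (simp add: divide_less_eq)
  then have "(1 / z) ^ p < ((1 - a) * (1 / x) + a * (1 / y)) ^ p"
    using z assms by (intro power_strict_mono) auto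
  also have "\<dots> \<le> (1 - a) * (1 / x) ^ p + a * (1 / y) ^ p"
    using convex_onD[OF convex_power_nonneg[of p], of a "1 / x" "1 / y"] assms by simp
  finally show ?thesis
    by (simp add: z_def power_divide)
qed

lemma Polygamma_diff_sums:
  fixes w z :: "'a :: {real_normed_field, banach}"
  assumes "w \<noteq> 0" "z \<noteq> 0"
  shows "(\<lambda>i. inverse ((z + of_nat i) ^ Suc m) - inverse ((w + of_nat i) ^ Suc m)) sums
           ((-1) ^ m * (Polygamma m w - Polygamma m z) / fact m)"
\<comment> \<open>For \<open>m = 0\<close> the reciprocals alone form divergent series; the
  regularising terms \<open>1 / (i + 1)\<close> and the Euler constant in \<open>Digamma\<close>
  cancel in the difference. For larger \<open>m\<close> both series converge separately.\<close>
proof (cases "m = 0")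
  case True
  then show ?thesis
    using sums_diff[OF summable_sums[OF summable_Digamma[OF assms(1)]]
        summable_sums[OF summable_Digamma[OF assms(2)]]]
    by (simp add: Digamma_def)
next
  case False
  have sq: "(-1) ^ m * ((-1) ^ m * c) = (c :: 'a)" for c
    by (simp flip: mult.assoc power_add)
  have P: "(-1) ^ m * Polygamma m u / fact m = - (\<Sum>i. inverse ((u + of_nat i) ^ Suc m))" for u :: 'a
    using False by (simp add: Polygamma_def sq mult.assoc del: power_Suc) (simp add: sq)
  have "(-1) ^ m * (Polygamma m w - Polygamma m z) / fact m =
      (\<Sum>i. inverse ((z + of_nat i) ^ Suc m)) - (\<Sum>i. inverse ((w + of_nat i) ^ Suc m))"
    using P[of w] P[of z] by (simp add: right_diff_distrib diff_divide_distrib)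
  then show ?thesis
    using sums_diff[OF summable_sums[OF Polygamma_converges'[OF assms(2)]]
        summable_sums[OF Polygamma_converges'[OF assms(1)]], of "Suc m" "Suc m"] False
    by simp
qed

lemma Polygamma_diff_gt:
  fixes a x :: real
  assumes "0 < a" "a < 1" "0 < x"
  shows "a * fact m / x ^ (m + 1) < (-1) ^ m * (Polygamma m (x + a) - Polygamma m x)"
proof -
  define h where "h = (\<lambda>t::real. inverse (t ^ Suc m))"
  \<comment> \<open>The decay of \<open>h\<close> at infinity makes the telescoping series sum to
    exactly \<open>a * h x\<close>.\<close>
  have "filterlim (\<lambda>i. x + real i) at_infinity sequentially"
    by (rule tendsto_add_filterlim_at_infinity[OF tendsto_const tendsto_of_nat])
  then have "(\<lambda>i. h (x + real i)) \<longlonglongrightarrow> 0"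
    unfolding h_def
    using tendsto_power[OF filterlim_compose[OF tendsto_inverse_0],
        of "\<lambda>i. x + real i" sequentially "Suc m"]
    by (simp add: power_inverse del: power_Suc)
  then have "(\<lambda>i. a * (h (x + real i) - h (x + real (Suc i)))) sums (a * (h x - 0))"
    using telescope_sums'[of "\<lambda>i. h (x + real i)" 0] by (intro sums_mult) simp
  moreover have "(\<lambda>i. h (x + real i) - h (x + a + real i)) sums
      ((-1) ^ m * (Polygamma m (x + a) - Polygamma m x) / fact m)"
    unfolding h_def using assms by (intro Polygamma_diff_sums) auto
  ultimately have sums: "(\<lambda>i. h (x + real i) - h (x + a + real i)
        - a * (h (x + real i) - h (x + real (Suc i)))) sums
      ((-1) ^ m * (Polygamma m (x + a) - Polygamma m x) / fact m - a * h x)"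
    using sums_diff by fastforce
  \<comment> \<open>Collecting the multiples of \<open>h (x + real i)\<close> turns this term into
    the convexity gap of \<open>h\<close> at \<open>x + a + real i\<close>.\<close>
  have "0 < h (x + real i) - h (x + a + real i) - a * (h (x + real i) - h (x + real (Suc i)))" for i
  proof -
    have "x + a + real i = (1 - a) * (x + real i) + a * (x + real (Suc i))"
      by (simp add: algebra_simps)
    then have "h (x + a + real i) < (1 - a) * h (x + real i) + a * h (x + real (Suc i))"
      using inverse_power_strict_convex[of "x + real i" "x + real (Suc i)" a "Suc m"] assms
      by (simp add: h_def inverse_eq_divide del: power_Suc)
    then show ?thesis
      by (simp add: algebra_simps)
  qed
  then have "0 < (-1) ^ m * (Polygamma m (x + a) - Polygamma m x) / fact m - a * h x"
    using suminf_pos[OF sums_summable[OF sums]] sums_unique[OF sums] by simp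
  then have "a * h x * fact m < (-1) ^ m * (Polygamma m (x + a) - Polygamma m x)"
    by (simp add: less_divide_eq)
  then show ?thesis
    by (simp add: h_def divide_inverse mult_ac)
qed

text \<open>Openness of \<open>S\<close> makes the induction hypothesis hold near \<open>x\<close>,
  and \<open>deriv\<close> depends only on values near the point.\<close>

lemma higher_deriv_eqI:
  fixes F :: "nat \<Rightarrow> 'a \<Rightarrow> 'a :: real_normed_field"
  assumes "open S" "x \<in> S"
    and deriv: "\<And>n x. x \<in> S \<Longrightarrow> (F n has_field_derivative F (Suc n) x) (at x)"
  shows "(deriv ^^ n) (F 0) x = F n x"
  using assms(2)
proof (induction n arbitrary: x)
  case (Suc n)
  have "eventually (\<lambda>y. (deriv ^^ n) (F 0) y = F n y) (nhds x)"
    using eventually_nhds_in_open[OF assms(1) Suc.prems] Suc.IH by (auto elim: eventually_mono)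
  then have "deriv ((deriv ^^ n) (F 0)) x = deriv (F n) x"
    by (rule deriv_cong_ev) simp
  then show ?case
    using DERIV_imp_deriv[OF deriv[OF Suc.prems]] by simp
qed simp

theorem theorem2p3:
  fixes a :: real and k :: nat
  assumes "a \<in> {0<..<1}"
    and "even k"
  shows "strictly_completely_monotonic
    (\<lambda>x. Polygamma k (x + a) - Polygamma k x - a * fact k / x ^ (k + 1))"
proof -
  \<comment> \<open>\<open>F n\<close> is the candidate for the \<open>n\<close>-th derivative: each
    differentiation of the power of \<open>1 / x\<close> flips the sign and extends the factorial by
    one factor.\<close>
  define F where "F = (\<lambda>n x. Polygamma (k + n) (x + a) - Polygamma (k + n) x
    - (-1) ^ n * (a * fact (k + n) / x ^ (k + n + 1)))"
  have a: "0 < a" "a < 1"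
    using assms by auto
  have pos: "t \<notin> \<int>\<^sub>\<le>\<^sub>0" if "t > 0" for t :: real
    using that by (auto elim!: nonpos_Ints_cases)
  have F_deriv: "(F n has_field_derivative F (Suc n) x) (at x)" if "x \<in> {0<..}" for n x
  proof -
    have P: "((\<lambda>x. Polygamma (k + n) (x + a) - Polygamma (k + n) x) has_field_derivative
        Polygamma (k + Suc n) (x + a) - Polygamma (k + Suc n) x) (at x)"
      using that a by (auto intro!: derivative_eq_intros pos)
    have "((\<lambda>x. inverse (x ^ Suc (k + n))) has_field_derivative
        - (real (k + n + 1) / x ^ (k + n + 2))) (at x)"
      by (rule DERIV_cong[OF DERIV_inverse_fun[OF DERIV_power_Suc[OF DERIV_ident]]])
        (use that in \<open>simp_all add: field_simps\<close>)
    note DERIV_cmult[OF this, of "(-1) ^ n * (a * fact (k + n))"]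
    then have "((\<lambda>x. Polygamma (k + n) (x + a) - Polygamma (k + n) x
        - (-1) ^ n * (a * fact (k + n)) * inverse (x ^ Suc (k + n))) has_field_derivative
        F (Suc n) x) (at x)"
      by (rule DERIV_cong[OF DERIV_diff[OF P]]) (use that in \<open>simp add: F_def field_simps\<close>)
    then show ?thesis
      by (simp add: F_def divide_inverse mult.assoc)
  qed
  have F: "(deriv ^^ n) (F 0) x = F n x" if "x > 0" for n x
    using that by (intro higher_deriv_eqI[where S = "{0<..}"] F_deriv) auto
  have "(deriv ^^ n) (F 0) differentiable (at x)" if "x > 0" for n x
  proof -
    have "((deriv ^^ n) (F 0) has_field_derivative F (Suc n) x) (at x)"
      using F_deriv[of x n] that
      by (rule_tac has_field_derivative_transform_within_open[where S = "{0<..}"]) (auto simp: F)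
    then show ?thesis
      by (auto simp: real_differentiable_def)
  qed
  \<comment> \<open>Since \<open>k\<close> is even, \<open>(-1) ^ (k + n)\<close> equals
    \<open>(-1) ^ n\<close>, and the two signs on the rational term cancel.\<close>
  moreover have "(-1) ^ n * (deriv ^^ n) (F 0) x > 0" if "x > 0" for n x
    using Polygamma_diff_gt[OF a that, of "k + n"] assms(2)
    by (simp add: F[OF that]) (simp add: F_def power_add right_diff_distrib flip: mult.assoc power_mult_distrib)
  ultimately have "strictly_completely_monotonic (F 0)"
    by (simp add: strictly_completely_monotonic_def)
  then show ?thesis
    by (simp add: F_def)
qed

end
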